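(* For every integer $k \ge 3$, there exists an $AP_{k}$-covering sequence $A \subseteq \mathbb{N}$ such that \[ A(n) \ll_{k} (\log n)^{1/(k-1)}\, n^{\frac{k-2}{k-1}}. \]
   Context: $\mathbb{N}$ denotes the set of all nonnegative integers. For an integer $k\ge 3$, a set (sequence) $A \subseteq \mathbb{N}$ is called an $AP_{k}$-covering sequence if there exists an integer $n_{0}$ such that for every integer $n > n_{0}$ there exist $a_{1}, \dots, a_{k-1} \in A$ with $a_{1} < \cdots < a_{k-1} < n$ such that $a_{1}, \dots, a_{k-1}, n$ form a $k$-term arithmetic progression. For $A\subseteq \mathbb{N}$, $A(n)$ denotes the number of elements of $A$ up to $n$, i.e. $A(n) = |\{a \in A : a \le n\}|$. The notation $f \ll_k g$ means $f = O(g)$ with an implied constant depending only on $k$: there is a constant $C_k>0$ depending only on $k$ such that $f(n) \le C_k\, g(n)$ for all sufficiently large $n$. *)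

theory Defs
  imports Complex_Main
begin

text \<open>The difference is taken in the integers, so that subtraction is not truncated.\<close>

definition arith_prog :: "nat list \<Rightarrow> bool" where
  "arith_prog xs \<longleftrightarrow>
     (\<exists>d::int. \<forall>i. Suc i < length xs \<longrightarrow> int (xs ! Suc i) - int (xs ! i) = d)"

text \<open>The list \<open>as\<close> is the tuple \<open>a\<^sub>1, \<dots>, a\<^sub>k\<^sub>-\<^sub>1\<close>. Sortedness of \<open>as @ [n]\<close> expresses
  \<open>a\<^sub>1 < \<dots> < a\<^sub>k\<^sub>-\<^sub>1 < n\<close>. The threshold \<open>n\<^sub>0\<close> can be taken to be a natural number because
  enlarging it only weakens the condition.\<close>

definition AP_covering :: "nat \<Rightarrow> nat set \<Rightarrow> bool" where
  "AP_covering k A \<longleftrightarrow>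
     (\<exists>n0::nat. \<forall>n>n0. \<exists>as::nat list.
        length as = k - 1 \<and> set as \<subseteq> A \<and>
        sorted_wrt (<) (as @ [n]) \<and> arith_prog (as @ [n]))"

definition counting :: "nat set \<Rightarrow> nat \<Rightarrow> nat" where
  "counting A n = card {a \<in> A. a \<le> n}"

end

theory Submission
  imports Defs "HOL-Library.FuncSet" "HOL-Library.Disjoint_Sets"
begin

text \<open>
  Write \<open>r = k - 1\<close>. The set \<open>A\<close> is a union of sets \<open>B\<^sub>m\<close>, one for each block \<open>[N, 2N)\<close> with
  \<open>N = 2r(r+1)t\<close> and \<open>t = 2^m\<close>, where \<open>B\<^sub>m\<close> lies in \<open>[N/2, 2N)\<close> and covers every \<open>n\<close> in the
  block. For such \<open>n\<close> only the progressions \<open>n - d, \<dots>, n - rd\<close> with \<open>rt \<le> d < rt + t\<close> are used.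
  These are \<open>t\<close> sets of size \<open>r\<close>, all inside \<open>[N/2, 2N)\<close>. They are pairwise disjoint, because
  the ratio of two of these differences is less than \<open>1 + 1/r\<close>, whereas \<open>j/i \<ge> 1 + 1/i > 1 + 1/r\<close>
  for \<open>1 \<le> i < j \<le> r\<close> (\<open>disjoint_progressions\<close>).

  Colour \<open>[N/2, 2N)\<close> uniformly at random with \<open>q\<close> colours. By disjointness, the probability
  that no progression for \<open>n\<close> is monochromatic of a given colour is
  \<open>(1 - q^(-r))^t \<le> exp (- t / q^r)\<close> (\<open>card_avoiding_colourings\<close>). If \<open>q^r \<le> t / (4 ln N)\<close>, this
  is at most \<open>N^(-4)\<close>, so a union bound over all colours and all \<open>n\<close> gives a colouring
  in which every colour class covers the whole block. The smallest class has at most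
  \<open>2N/q\<close> elements (\<open>exists_small_covering_class\<close>), and the largest admissible \<open>q\<close> makes this
  \<open>O(N^(1 - 1/r) (ln N)^(1/r))\<close> (\<open>covering_block\<close>). Requiring every class to cover replaces
  a separate tail estimate for the size of a random set.

  As \<open>B\<^sub>m\<close> has no elements below \<open>N/2\<close>, only blocks with \<open>N \<le> 2n\<close> contribute to the counting
  function at \<open>n\<close>, and their bounds add up to a geometric sum dominated by its last term.
\<close>

section \<open>Colourings without monochromatic sets\<close>

text \<open>In a uniformly random colouring, the events that the disjoint sets \<open>T i\<close> fail to be
  monochromatic of colour \<open>c\<close> are independent; stated as a bound on the number of colourings.\<close>

lemma card_avoiding_colourings:
  fixes T :: "'i \<Rightarrow> 'a set" and Q :: "'c set"
  assumes "finite I" "finite X" "finite Q" "c \<in> Q"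
    and "\<And>i. i \<in> I \<Longrightarrow> T i \<subseteq> X \<and> card (T i) = r"
    and "disjoint_family_on T I"
  shows "real (card {f \<in> X \<rightarrow>\<^sub>E Q. \<forall>i\<in>I. \<exists>x\<in>T i. f x \<noteq> c})
           \<le> real (card Q) ^ card X * (1 - 1 / real (card Q) ^ r) ^ card I"
  using assms(1,2,5,6)
proof (induction I arbitrary: X rule: finite_induct)
  case empty
  then show ?case by (simp add: card_PiE)
next
  case (insert i I)
  define S where "S Y J = {f \<in> Y \<rightarrow>\<^sub>E Q. \<forall>i\<in>J. \<exists>x\<in>T i. f x \<noteq> c}" for Y J
  define Z where "Z = T i"
  define g where "g f = (restrict f Z, restrict f (X - Z))" for f :: "'a \<Rightarrow> 'c"
  define q where "q = card Q"
  have Z: "Z \<subseteq> X" "card Z = r" "finite Z"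
    using insert.prems by (auto simp: Z_def intro: rev_finite_subset)
  have disj: "T j \<inter> Z = {}" if "j \<in> I" for j
    using disjoint_family_onD[OF insert.prems(3), of j i] that insert.hyps(2) by (auto simp: Z_def)
  have sub: "T j \<subseteq> X - Z" if "j \<in> I" for j
    using disj[OF that] insert.prems(2)[of j] that by blast
  have q: "q > 0" using assms(3,4) by (auto simp: q_def card_gt_0_iff)
  have fin: "finite (S Y J)" if "finite Y" for Y J
    using finite_PiE[OF that, of "\<lambda>_. Q"] assms(3) by (auto simp: S_def intro: rev_finite_subset)
  \<comment> \<open>Restriction to \<open>T i\<close> and to its complement splits off the factor belonging to \<open>T i\<close>.\<close>
  have "inj_on g (S X (insert i I))"
  proof (rule inj_onI)
    fix f h assume fh: "f \<in> S X (insert i I)" "h \<in> S X (insert i I)" "g f = g h"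
    show "f = h"
    proof (rule PiE_ext[of _ X "\<lambda>_. Q"])
      fix x assume "x \<in> X"
      then show "f x = h x"
        using fh(3) unfolding g_def prod.inject by (metis DiffI restrict_apply')
    qed (use fh in \<open>auto simp: S_def\<close>)
  qed
  moreover have "g ` S X (insert i I) \<subseteq> ((Z \<rightarrow>\<^sub>E Q) - {\<lambda>x\<in>Z. c}) \<times> S (X - Z) I"
  proof (rule image_subsetI)
    fix f assume f: "f \<in> S X (insert i I)"
    then obtain x where x: "x \<in> Z" "f x \<noteq> c" by (auto simp: S_def Z_def)
    have "restrict f Z \<noteq> (\<lambda>x\<in>Z. c)" using x by (metis restrict_apply')
    moreover have "restrict f Z \<in> Z \<rightarrow>\<^sub>E Q" using f Z(1) by (auto simp: S_def)
    moreover have "restrict f (X - Z) \<in> S (X - Z) I"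
    proof -
      have "\<exists>x\<in>T j. restrict f (X - Z) x \<noteq> c" if "j \<in> I" for j
        using f sub[OF that] that by (fastforce simp: S_def)
      moreover have "restrict f (X - Z) \<in> (X - Z) \<rightarrow>\<^sub>E Q" using f by (auto simp: S_def)
      ultimately show ?thesis by (simp add: S_def)
    qed
    ultimately show "g f \<in> ((Z \<rightarrow>\<^sub>E Q) - {\<lambda>x\<in>Z. c}) \<times> S (X - Z) I" by (simp add: g_def)
  qed
  moreover have finP: "finite (Z \<rightarrow>\<^sub>E Q)" using Z(3) assms(3) by (simp add: finite_PiE)
  ultimately have "card (S X (insert i I)) \<le> card (((Z \<rightarrow>\<^sub>E Q) - {\<lambda>x\<in>Z. c}) \<times> S (X - Z) I)"
    using fin[of "X - Z" I] insert.prems(1) by (intro card_inj_on_le[of g]) auto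
  also have "\<dots> = (q ^ r - 1) * card (S (X - Z) I)"
  proof -
    have "card (Z \<rightarrow>\<^sub>E Q) = q ^ r" using Z by (simp add: card_PiE q_def)
    moreover have "(\<lambda>x\<in>Z. c) \<in> Z \<rightarrow>\<^sub>E Q" using assms(4) by auto
    ultimately show ?thesis using finP by (simp add: card_cartesian_product)
  qed
  finally have "real (card (S X (insert i I))) \<le> real (q ^ r - 1) * real (card (S (X - Z) I))"
    by (metis of_nat_le_iff of_nat_mult)
  also have "\<dots> \<le> real (q ^ r - 1) * (real q ^ card (X - Z) * (1 - 1 / real q ^ r) ^ card I)"
  proof (rule mult_left_mono)
    show "real (card (S (X - Z) I)) \<le> real q ^ card (X - Z) * (1 - 1 / real q ^ r) ^ card I"
      unfolding S_def q_def
    proof (rule insert.IH)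
      show "disjoint_family_on T I"
        using insert.prems(3) by (auto simp: disjoint_family_on_def)
    qed (use insert.prems sub in auto)
  qed simp
  also have "real (q ^ r - 1) = real q ^ r * (1 - 1 / real q ^ r)"
    using q by (simp add: of_nat_diff field_simps)
  also have "real q ^ r * (1 - 1 / real q ^ r) * (real q ^ card (X - Z) * (1 - 1 / real q ^ r) ^ card I)
     = (real q ^ r * real q ^ card (X - Z)) * ((1 - 1 / real q ^ r) * (1 - 1 / real q ^ r) ^ card I)"
    by (simp only: mult_ac)
  also have "real q ^ r * real q ^ card (X - Z) = real q ^ card X"
  proof -
    have "r + card (X - Z) = card X"
      using Z insert.prems(1) by (metis card_Diff_subset card_mono le_add_diff_inverse)
    then show ?thesis by (metis power_add)
  qed
  finally show ?case using insert.hyps by (simp add: S_def q_def)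
qed

text \<open>The set \<open>B\<close> is a colour class of at most average size in a colouring in which every
  class contains, for every \<open>n\<close>, some \<open>T n i\<close>.\<close>

lemma exists_small_covering_class:
  fixes T :: "'n \<Rightarrow> 'i \<Rightarrow> 'a set"
  assumes "finite X" "finite M" "finite I" "q > 0"
    and T: "\<And>n i. n \<in> M \<Longrightarrow> i \<in> I \<Longrightarrow> T n i \<subseteq> X \<and> card (T n i) = r"
    and disj: "\<And>n. n \<in> M \<Longrightarrow> disjoint_family_on (T n) I"
    and small: "real q * real (card M) * (1 - 1 / real q ^ r) ^ card I < 1"
  shows "\<exists>B\<subseteq>X. q * card B \<le> card X \<and> (\<forall>n\<in>M. \<exists>i\<in>I. T n i \<subseteq> B)"
proof -
  define S where "S c n = {f \<in> X \<rightarrow>\<^sub>E {..<q}. \<forall>i\<in>I. \<exists>x\<in>T n i. f x \<noteq> c}" for c n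
  define E where "E = real q ^ card X * (1 - 1 / real q ^ r) ^ card I"
  have S: "real (card (S c n)) \<le> E" if "c < q" "n \<in> M" for c n
    using card_avoiding_colourings[of I X "{..<q}" c "T n" r] that assms by (simp add: S_def E_def)
  have fin: "finite (X \<rightarrow>\<^sub>E {..<q})" using assms(1) by (simp add: finite_PiE)
  \<comment> \<open>Union bound over the pairs of a colour and an index \<open>n\<close>.\<close>
  have "real (card (\<Union>(c,n)\<in>{..<q}\<times>M. S c n)) \<le> (\<Sum>(c,n)\<in>{..<q}\<times>M. real (card (S c n)))"
    using card_UN_le[of "{..<q}\<times>M" "\<lambda>(c,n). S c n"] assms(2)
    by (simp add: case_prod_unfold flip: of_nat_sum)
  also have "\<dots> \<le> (\<Sum>(c,n)\<in>{..<q}\<times>M. E)"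
    by (intro sum_mono) (auto intro: S)
  also have "\<dots> = real q ^ card X * (real q * real (card M) * (1 - 1 / real q ^ r) ^ card I)"
    by (simp add: E_def card_cartesian_product)
  also have "\<dots> < real q ^ card X * 1"
    using small assms(4) by (intro mult_strict_left_mono) auto
  also have "\<dots> = real (card (X \<rightarrow>\<^sub>E {..<q}))" using assms(1) by (simp add: card_PiE)
  finally have less: "card (\<Union>(c,n)\<in>{..<q}\<times>M. S c n) < card (X \<rightarrow>\<^sub>E {..<q})" by simp
  have "\<not> (X \<rightarrow>\<^sub>E {..<q}) \<subseteq> (\<Union>(c,n)\<in>{..<q}\<times>M. S c n)"
  proof
    assume "(X \<rightarrow>\<^sub>E {..<q}) \<subseteq> (\<Union>(c,n)\<in>{..<q}\<times>M. S c n)"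
    moreover have "finite (\<Union>(c,n)\<in>{..<q}\<times>M. S c n)"
      by (rule finite_subset[OF _ fin]) (auto simp: S_def)
    ultimately show False using card_mono less by (metis not_le)
  qed
  then obtain f where f: "f \<in> X \<rightarrow>\<^sub>E {..<q}" "f \<notin> (\<Union>(c,n)\<in>{..<q}\<times>M. S c n)" by blast
  define B where "B c = {x\<in>X. f x = c}" for c
  have cover: "\<forall>n\<in>M. \<exists>i\<in>I. T n i \<subseteq> B c" if c: "c < q" for c
  proof
    fix n assume n: "n \<in> M"
    have "f \<notin> S c n" using f(2) c n by blast
    then obtain i where "i \<in> I" "\<forall>x\<in>T n i. f x = c"
      using f(1) unfolding S_def by blast
    then show "\<exists>i\<in>I. T n i \<subseteq> B c" using T[OF n, of i] by (auto simp: B_def)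
  qed
  have "\<exists>c<q. q * card (B c) \<le> card X"
  proof (rule ccontr)
    assume "\<not> ?thesis"
    then have "(\<Sum>c<q. q * card (B c)) > (\<Sum>c<q. card X)"
      using assms(4) by (intro sum_strict_mono) (auto simp: not_le)
    moreover have "(\<Sum>c<q. card (B c)) = card (\<Union>c<q. B c)"
      using assms(1) by (intro card_UN_disjoint[symmetric]) (auto simp: B_def)
    moreover have "(\<Union>c<q. B c) = X" using f(1) by (auto simp: B_def)
    ultimately show False by (simp flip: sum_distrib_left)
  qed
  then obtain c where "c < q" "q * card (B c) \<le> card X" by auto
  then show ?thesis using cover[of c] by (intro exI[of _ "B c"]) (auto simp: B_def)
qed

section \<open>Progressions with a common endpoint\<close>

lemma multiples_eq_imp_eq:
  fixes d d' :: nat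
  assumes d: "d \<in> {r * t..<r * t + t}" "d' \<in> {r * t..<r * t + t}"
    and ij: "i \<in> {1..r}" "j \<in> {1..r}" and eq: "i * d = j * d'"
  shows "d = d'"
proof -
  \<comment> \<open>If \<open>i < j\<close>, then \<open>d \<ge> (1 + 1/i) d'\<close>, so \<open>d\<close> lies beyond the window, as \<open>i < r\<close>.\<close>
  have *: False
    if "i < j" "j \<le> r" "i * d = j * d'" "r * t \<le> d'" "d < r * t + t" for i j d d' :: nat
  proof -
    have "(i + 1) * d' \<le> i * d" using that(1) unfolding that(3) by (intro mult_le_mono1) simp
    also have "i * d \<le> i * (r * t + t)" using that(5) by (intro mult_le_mono2) simp
    finally have "i * d' + d' \<le> i * (r * t) + i * t" by (simp add: algebra_simps)
    moreover have "i * (r * t) \<le> i * d'" using that by simp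
    ultimately have "r * t \<le> i * t" using that(4) by linarith
    moreover have "t > 0" using that by (cases t) auto
    ultimately show False using that by simp
  qed
  have "i = j"
    using *[of i j d d'] *[of j i d' d] assms
    by (metis atLeastAtMost_iff atLeastLessThan_iff linorder_neqE_nat)
  then show ?thesis using eq ij by simp
qed

lemma disjoint_progressions:
  fixes n :: nat
  assumes "r * (r * t + t) \<le> n"
  shows "disjoint_family_on (\<lambda>d. (\<lambda>j. n - j * d) ` {1..r}) {r * t..<r * t + t}"
  unfolding disjoint_family_on_def
proof (intro ballI impI)
  fix d d' assume dd: "d \<in> {r * t..<r * t + t}" "d' \<in> {r * t..<r * t + t}" "d \<noteq> d'"
  have le: "j * e \<le> n" if "j \<le> r" "e < r * t + t" for j e
    using mult_le_mono[of j r e "r * t + t"] that assms by simp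
  have False if ij: "i \<in> {1..r}" "j \<in> {1..r}" and eq: "n - i * d = n - j * d'" for i j
  proof -
    have "i * d = j * d'" using eq le[of i d] le[of j d'] ij dd by simp
    then show False using multiples_eq_imp_eq[OF dd(1,2) ij] dd(3) by simp
  qed
  then show "(\<lambda>j. n - j * d) ` {1..r} \<inter> (\<lambda>j. n - j * d') ` {1..r} = {}" by blast
qed

section \<open>Covering a dyadic block\<close>

text \<open>\<open>covers r B n\<close>: the set \<open>B\<close> contains the \<open>r\<close> terms preceding \<open>n\<close> in some progression with
  last term \<open>n\<close> and positive difference. The condition \<open>r * d \<le> n\<close> keeps the subtraction of
  natural numbers from being truncated.\<close>

definition covers :: "nat \<Rightarrow> nat set \<Rightarrow> nat \<Rightarrow> bool" where
  "covers r B n \<longleftrightarrow> (\<exists>d>0. r * d \<le> n \<and> (\<forall>j\<in>{1..r}. n - j * d \<in> B))"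

lemma AP_covering_if_covers:
  assumes "\<And>n. n > n0 \<Longrightarrow> covers r A n"
  shows "AP_covering (Suc r) A"
  unfolding AP_covering_def
proof (intro exI[of _ n0] allI impI)
  fix n assume "n > n0"
  then obtain d where d: "d > 0" "r * d \<le> n" "\<And>j. j \<in> {1..r} \<Longrightarrow> n - j * d \<in> A"
    using assms unfolding covers_def by blast
  define f where "f i = n - (r - i) * d" for i
  have le: "(r - i) * d \<le> n" for i
    using d(2) by (meson diff_le_self le_trans mult_le_mono1)
  have app: "map f [0..<r] @ [n] = map f [0..<Suc r]" by (simp add: f_def)
  have int_f: "int (f i) = int n - (int r - int i) * int d" if "i \<le> r" for i
    using that le[of i] by (simp add: f_def of_nat_diff)
  have "arith_prog (map f [0..<Suc r])"
    unfolding arith_prog_def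
    by (rule exI[of _ "int d"]) (auto simp: int_f algebra_simps simp del: upt_Suc)
  moreover have "sorted_wrt (<) (map f [0..<Suc r])"
  proof -
    have "f i < f j" if "i < j" "j \<le> r" for i j
    proof -
      have "(int r - int j) * int d < (int r - int i) * int d"
        using that d(1) by (intro mult_strict_right_mono) auto
      then show ?thesis using int_f[of i] int_f[of j] that by linarith
    qed
    then show ?thesis by (auto simp: sorted_wrt_iff_nth_less simp del: upt_Suc)
  qed
  moreover have "set (map f [0..<r]) \<subseteq> A" using d(3) by (auto simp: f_def)
  ultimately show "\<exists>as. length as = Suc r - 1 \<and> set as \<subseteq> A \<and>
      sorted_wrt (<) (as @ [n]) \<and> arith_prog (as @ [n])"
    by (intro exI[of _ "map f [0..<r]"]) (simp only: app, simp)
qed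

lemma covering_set_of_block:
  fixes r t q N :: nat
  assumes r: "r \<ge> 1" and t: "t \<ge> 1" and q: "q \<ge> 1" and N: "N = 2 * r * (r + 1) * t"
    and small: "real q * real N * (1 - 1 / real q ^ r) ^ t < 1"
  shows "\<exists>B\<subseteq>{N div 2..<2 * N}. q * card B \<le> 2 * N \<and> (\<forall>n\<in>{N..<2 * N}. covers r B n)"
proof -
  define T where "T n d = (\<lambda>j. n - j * d) ` {1..r}" for n d :: nat
  define I where "I = {r * t..<r * t + t}"
  have half: "N div 2 = r * (r * t + t)" "2 * (N div 2) = N" by (auto simp: N algebra_simps)
  have I_pos: "d > 0" if "d \<in> I" for d
  proof -
    have "0 < r * t" using r t by simp
    also have "r * t \<le> d" using that by (simp add: I_def)
    finally show ?thesis .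
  qed
  have le: "j * d \<le> N div 2" if "j \<in> {1..r}" "d \<in> I" for j d
    using mult_le_mono[of j r d "r * t + t"] that unfolding half(1) by (simp add: I_def)
  have "\<exists>B\<subseteq>{N div 2..<2 * N}. q * card B \<le> card {N div 2..<2 * N} \<and>
          (\<forall>n\<in>{N..<2 * N}. \<exists>d\<in>I. T n d \<subseteq> B)"
  proof (rule exists_small_covering_class)
    fix n d assume n: "n \<in> {N..<2 * N}" and d: "d \<in> I"
    have "inj_on (\<lambda>j. n - j * d) {1..r}"
    proof (rule inj_onI)
      fix i j assume ij: "i \<in> {1..r}" "j \<in> {1..r}" and eq: "n - i * d = n - j * d"
      have "N div 2 \<le> n" using n by auto
      then have "i * d = j * d" using le[OF ij(1) d] le[OF ij(2) d] eq by linarith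
      then show "i = j" using I_pos[OF d] by simp
    qed
    then have "card (T n d) = r" by (simp add: T_def card_image)
    moreover have "n - j * d \<in> {N div 2..<2 * N}" if "j \<in> {1..r}" for j
      using le[OF that d] n by auto
    ultimately show "T n d \<subseteq> {N div 2..<2 * N} \<and> card (T n d) = r"
      unfolding T_def by blast
  next
    fix n assume n: "n \<in> {N..<2 * N}"
    then have "r * (r * t + t) \<le> n" using half(1) by auto
    then show "disjoint_family_on (T n) I"
      unfolding T_def I_def by (rule disjoint_progressions)
  next
    show "real q * real (card {N..<2 * N}) * (1 - 1 / real q ^ r) ^ card I < 1"
      using small by (simp add: I_def)
  qed (use q in \<open>auto simp: I_def\<close>)
  then obtain B where B: "B \<subseteq> {N div 2..<2 * N}" "q * card B \<le> card {N div 2..<2 * N}"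
    "\<And>n. n \<in> {N..<2 * N} \<Longrightarrow> \<exists>d\<in>I. T n d \<subseteq> B" by blast
  have "covers r B n" if n: "n \<in> {N..<2 * N}" for n
  proof -
    obtain d where d: "d \<in> I" "T n d \<subseteq> B" using B(3)[OF n] by blast
    have "r * d \<le> n" using le[of r d] d(1) r n by auto
    then show ?thesis unfolding covers_def
      using I_pos[OF d(1)] d(2) by (intro exI[of _ d]) (auto simp: T_def)
  qed
  moreover have "q * card B \<le> 2 * N" using B(2) by simp
  ultimately show ?thesis using B(1) by blast
qed

text \<open>Since \<open>N\<close> is a constant multiple of \<open>t\<close>, the bound is of order
  \<open>N^(1 - 1/r) (ln N)^(1/r)\<close>. If \<open>(t / (4 ln N))^(1/r) < 1\<close>, no number of colours \<open>q \<ge> 1\<close> is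
  admissible, but the bound then exceeds \<open>4 N\<close> and the full interval will do. So no
  lower bound on \<open>N\<close> is needed.\<close>

lemma covering_block:
  fixes r t N :: nat
  assumes r: "r \<ge> 1" and t: "t \<ge> 1" and N: "N = 2 * r * (r + 1) * t"
  shows "\<exists>B\<subseteq>{N div 2..<2 * N}. (\<forall>n\<in>{N..<2 * N}. covers r B n) \<and>
     real (card B) \<le> 4 * real N / (real t / (4 * ln (real N))) powr (1 / real r)"
proof -
  define y where "y = real t / (4 * ln (real N))"
  define x where "x = y powr (1 / real r)"
  have "2 * 1 * (1 + 1) * 1 \<le> N" unfolding N using r t by (intro mult_le_mono) auto
  then have N4: "N \<ge> 4" by simp
  have "exp 1 \<le> real N" using exp_le N4 by linarith
  then have ln1: "ln (real N) \<ge> 1" using N4 by (subst ln_ge_iff) auto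
  have y: "y > 0" using ln1 t by (simp add: y_def)
  have x: "x > 0" using y by (simp add: x_def)
  have xr: "x ^ r = y"
    using y r by (simp add: x_def powr_powr flip: powr_realpow)
  have tN: "t \<le> N" unfolding N using r by simp
  show ?thesis
  proof (cases "\<exists>q\<ge>1. real q \<le> x \<and> x \<le> 2 * real q")
    case True
    then obtain q where q: "q \<ge> 1" "real q \<le> x" "x \<le> 2 * real q" by blast
    have qr: "real q ^ r \<le> y" using power_mono[OF q(2), of r] xr by simp
    have "q ^ 1 \<le> q ^ r" using q(1) r by (intro power_increasing)
    then have "real q \<le> real q ^ r" by (simp flip: of_nat_power)
    also note qr
    also have "y \<le> real t"
      using ln1 mult_left_mono[of 1 "4 * ln (real N)" "real t"] by (simp add: y_def field_simps)
    finally have qN: "real q \<le> real N" using tN by linarith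
    have qr1: "real q ^ r \<ge> 1" using q(1) by simp
    have inv_le: "1 / real q ^ r \<le> 1" using qr1 q(1) by (subst pos_divide_le_eq) auto
    have exponent: "4 * ln (real N) \<le> real t / real q ^ r"
      using qr ln1 qr1 q(1) by (subst pos_le_divide_eq) (simp_all add: y_def field_simps)
    have "1 - 1 / real q ^ r \<le> exp (- (1 / real q ^ r))"
      using exp_ge_add_one_self[of "- (1 / real q ^ r)"] by simp
    then have "(1 - 1 / real q ^ r) ^ t \<le> exp (- (1 / real q ^ r)) ^ t"
      using inv_le by (intro power_mono) auto
    also have "\<dots> = exp (- (real t / real q ^ r))"
      by (simp flip: exp_of_nat_mult)
    also have "\<dots> \<le> exp (- (4 * ln (real N)))" using exponent by simp
    also have "\<dots> = 1 / real N ^ 4"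
      using N4 by (simp add: exp_minus exp_of_nat_mult[of 4, simplified] inverse_eq_divide)
    finally have P: "(1 - 1 / real q ^ r) ^ t \<le> 1 / real N ^ 4" .
    have "real q * real N * (1 - 1 / real q ^ r) ^ t \<le> real N * real N * (1 / real N ^ 4)"
      using P qN inv_le by (intro mult_mono) auto
    also have "\<dots> = 1 / real N ^ 2" using N4 by (simp add: field_simps eval_nat_numeral)
    also have "\<dots> < 1" using N4 by simp
    finally obtain B where B: "B \<subseteq> {N div 2..<2 * N}" "q * card B \<le> 2 * N"
        "\<forall>n\<in>{N..<2 * N}. covers r B n"
      using covering_set_of_block[OF r t q(1) N] by blast
    have "real (card B) * x \<le> real (card B) * (2 * real q)" using q(3) by (intro mult_left_mono) auto
    also have "\<dots> = 2 * real (q * card B)" by simp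
    also have "\<dots> \<le> 2 * real (2 * N)" using of_nat_mono[OF B(2)] by (rule mult_left_mono) simp
    finally have "real (card B) \<le> 4 * real N / x" using x by (simp add: field_simps)
    with B show ?thesis unfolding x_def y_def by blast
  next
    case False
    have x1: "x < 1"
    proof (rule ccontr)
      assume "\<not> x < 1"
      then have floor: "1 \<le> \<lfloor>x\<rfloor>" by simp
      then have "real (nat \<lfloor>x\<rfloor>) = of_int \<lfloor>x\<rfloor>" by simp
      moreover have "1 \<le> (of_int \<lfloor>x\<rfloor> :: real)" using floor by simp
      ultimately have "real (nat \<lfloor>x\<rfloor>) \<le> x" "x \<le> 2 * real (nat \<lfloor>x\<rfloor>)"
        using floor_correct[of x] by linarith+
      with floor have "nat \<lfloor>x\<rfloor> \<ge> 1 \<and> real (nat \<lfloor>x\<rfloor>) \<le> x \<and> x \<le> 2 * real (nat \<lfloor>x\<rfloor>)" by simp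
      with False show False by blast
    qed
    obtain B where B: "B \<subseteq> {N div 2..<2 * N}" "\<forall>n\<in>{N..<2 * N}. covers r B n"
    proof
      show "\<forall>n\<in>{N..<2 * N}. covers r {N div 2..<2 * N} n"
      proof
        fix n assume n: "n \<in> {N..<2 * N}"
        have half: "N div 2 = r * ((r + 1) * t)" "2 * (N div 2) = N" by (auto simp: N algebra_simps)
        have "j * ((r + 1) * t) \<le> N div 2" if "j \<le> r" for j
          using that unfolding half(1) by simp
        then have "\<forall>j\<in>{1..r}. n - j * ((r + 1) * t) \<in> {N div 2..<2 * N}" 
          using n half(2) by fastforce
        moreover have "r * ((r + 1) * t) \<le> n" using half n by auto
        ultimately show "covers r {N div 2..<2 * N} n"
          unfolding covers_def using t by (intro exI[of _ "(r + 1) * t"]) auto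
      qed
    qed simp
    have "card B \<le> card {N div 2..<2 * N}" using B(1) by (intro card_mono) auto
    then have "real (card B) \<le> 4 * real N" by simp
    also have "\<dots> \<le> 4 * real N / x" using x x1 mult_right_mono[of x 1 "real N"] by (simp add: field_simps)
    finally show ?thesis using B unfolding x_def y_def by blast
  qed
qed

section \<open>Summing over the blocks\<close>

lemma exists_dyadic_interval:
  fixes K n :: nat
  assumes "K > 0" "K \<le> n"
  shows "\<exists>L. K * 2 ^ L \<le> n \<and> n < K * 2 ^ Suc L"
proof -
  have "\<exists>L. n < K * 2 ^ L"
  proof
    have "n < 1 * 2 ^ n" by simp
    also have "\<dots> \<le> K * 2 ^ n" using assms(1) by (intro mult_le_mono1) simp
    finally show "n < K * 2 ^ n" .
  qed
  then obtain L where L: "n < K * 2 ^ L" "\<And>m. m < L \<Longrightarrow> \<not> n < K * 2 ^ m"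
    using exists_least_iff[of "\<lambda>L. n < K * 2 ^ L"] by blast
  moreover have "L \<noteq> 0" using L(1) assms(2) by (cases L) auto
  ultimately show ?thesis by (metis lessI not_less not0_implies_Suc)
qed

lemma sum_powr_dyadic_le:
  fixes a K :: real
  assumes "a > 0" "K > 0"
  shows "(\<Sum>m\<le>L. (K * 2 ^ m) powr a) \<le> 2 powr a / (2 powr a - 1) * (K * 2 ^ L) powr a"
proof -
  define g where "g = 2 powr a"
  have g: "g > 1" using assms(1) by (simp add: g_def)
  have eq: "(K * 2 ^ m) powr a = K powr a * g ^ m" for m
    using assms by (simp add: powr_mult g_def powr_powr mult.commute flip: powr_realpow)
  have "(\<Sum>m\<le>L. g ^ m) = (g ^ Suc L - 1) / (g - 1)"
    using g geometric_sum[of g "Suc L"] by (simp only: lessThan_Suc_atMost)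
  also have "\<dots> \<le> g ^ Suc L / (g - 1)" using g by (intro divide_right_mono) auto
  finally have "K powr a * (\<Sum>m\<le>L. g ^ m) \<le> K powr a * (g ^ Suc L / (g - 1))"
    by (intro mult_left_mono) auto
  then show ?thesis by (simp add: eq sum_distrib_left g_def mult_ac)
qed

theorem theorem3:
  fixes k :: nat
  assumes "k \<ge> 3"
  shows "\<exists>C::real. C > 0 \<and> (\<exists>A::nat set. AP_covering k A \<and>
           (\<forall>\<^sub>F n in sequentially.
              real (counting A n) \<le>
                C * (ln (real n) powr (1 / (real k - 1)) *
                     real n powr ((real k - 2) / (real k - 1)))))"
proof -
  define r where "r = k - 1"
  have r: "r \<ge> 2" and k: "k = Suc r" using assms by (auto simp: r_def)
  define K where "K = 2 * r * (r + 1)"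
  define N where "N m = K * 2 ^ m" for m :: nat
  define a where "a = (real r - 1) / real r"
  define b where "b = 1 / real r"
  have ab: "a > 0" "b > 0" "a + b = 1" using r by (auto simp: a_def b_def field_simps)
  have K: "K \<ge> 4" unfolding K_def using r mult_le_mono[of 2 "2 * r" 2 "r + 1"] by simp
  have N4: "N m \<ge> 4" for m
    using K mult_le_mono[of 4 K 1 "2 ^ m"] by (simp add: N_def)
  define D where "D = 4 * (4 * real K) powr b"
  have D: "D > 0" using K by (simp add: D_def)
  \<comment> \<open>The bound of \<open>covering_block\<close>, with \<open>t = 2^m = N/K\<close> eliminated.\<close>
  have block_size: "4 * real (N m) / (real (2 ^ m) / (4 * ln (real (N m)))) powr (1 / real r)
      = D * (real (N m) powr a * ln (real (N m)) powr b)" for m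
  proof -
    have ln: "ln (real (N m)) > 0" using N4[of m] by simp
    have "real (2 ^ m) / (4 * ln (real (N m))) = real (N m) / (4 * real K * ln (real (N m)))"
      using K by (simp add: N_def)
    then have "(real (2 ^ m) / (4 * ln (real (N m)))) powr b
        = real (N m) powr b / ((4 * real K) powr b * ln (real (N m)) powr b)"
      using ln K by (simp add: powr_divide powr_mult)
    then have pow: "(real (2 ^ m) / (4 * ln (real (N m)))) powr (1 / real r)
        = real (N m) powr b / ((4 * real K) powr b * ln (real (N m)) powr b)"
      by (simp only: b_def)
    have split: "real (N m) = real (N m) powr a * real (N m) powr b"
      using ab(3) N4[of m] by (simp flip: powr_add)
    have quot: "4 * u / (v / (p * w)) = 4 * p * (z * w)" if "u = z * v" "v \<noteq> 0" for p u v w z :: real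
      using that by simp
    show ?thesis
      unfolding pow D_def using N4[of m] by (intro quot[OF split]) simp
  qed
  have "\<exists>B\<subseteq>{N m div 2..<2 * N m}. (\<forall>n\<in>{N m..<2 * N m}. covers r B n) \<and>
      real (card B) \<le> D * (real (N m) powr a * ln (real (N m)) powr b)" for m
    using covering_block[of r "2 ^ m" "N m"] r unfolding block_size by (simp add: N_def K_def)
  then obtain B where B: "\<And>m. B m \<subseteq> {N m div 2..<2 * N m}"
    "\<And>m n. n \<in> {N m..<2 * N m} \<Longrightarrow> covers r (B m) n"
    "\<And>m. real (card (B m)) \<le> D * (real (N m) powr a * ln (real (N m)) powr b)"
    by metis
  define A where "A = (\<Union>m. B m)"
  have "AP_covering k A"
    unfolding k
  proof (rule AP_covering_if_covers)
    fix n assume "n > K"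
    then obtain m where "N m \<le> n" "n < 2 * N m"
      using exists_dyadic_interval[of K n] K by (auto simp: N_def)
    then have "covers r (B m) n" using B(2) by simp
    then show "covers r A n" unfolding covers_def A_def by blast
  qed
  moreover define G where "G = 2 powr a / (2 powr a - 1)"
  have G: "G > 0" using ab by (simp add: G_def)
  have bound: "real (counting A n) \<le> 2 * D * G * (ln (real n) powr b * real n powr a)" if n: "n \<ge> K" for n
  proof -
    have n4: "n \<ge> 4" using n K by simp
    obtain L where L: "N L \<le> 2 * n" "2 * n < N (Suc L)"
      using exists_dyadic_interval[of K "2 * n"] K n by (auto simp: N_def)
    have "{x \<in> A. x \<le> n} \<subseteq> (\<Union>m\<le>L. B m)"
    proof
      fix x assume "x \<in> {x \<in> A. x \<le> n}"
      then obtain m where m: "x \<in> B m" "x \<le> n" by (auto simp: A_def)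
      have "N m div 2 \<le> n" using m B(1)[of m] by auto
      moreover have "even (N m)" by (simp add: N_def K_def)
      ultimately have "N m \<le> 2 * n" by auto
      then have "N m < N (Suc L)" using L(2) by simp
      then have "(2::nat) ^ m < 2 ^ Suc L" using K unfolding N_def by simp
      then have "m < Suc L" by (rule power_less_imp_less_exp[rotated]) simp
      then show "x \<in> (\<Union>m\<le>L. B m)" using m by auto
    qed
    moreover have "finite (B m)" for m using B(1) finite_subset by blast
    ultimately have "counting A n \<le> card (\<Union>m\<le>L. B m)"
      unfolding counting_def by (intro card_mono) auto
    also have "\<dots> \<le> (\<Sum>m\<le>L. card (B m))" by (rule card_UN_le) simp
    finally have "real (counting A n) \<le> (\<Sum>m\<le>L. real (card (B m)))" by (simp flip: of_nat_sum)
    also have "\<dots> \<le> (\<Sum>m\<le>L. D * (real (N m) powr a * (2 * ln (real n)) powr b))"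
    proof (intro sum_mono order.trans[OF B(3)] mult_left_mono powr_mono2)
      fix m assume "m \<in> {..L}"
      then have "N m \<le> N L" by (simp add: N_def)
      \<comment> \<open>The crude bound \<open>2n \<le> n\<^sup>2\<close> suffices inside the logarithm.\<close>
      also note L(1)
      also have "2 * n \<le> n * n" using n4 by (intro mult_le_mono1) simp
      finally have "real (N m) \<le> real n * real n" by (simp flip: of_nat_mult)
      then have "ln (real (N m)) \<le> ln (real n * real n)" using N4[of m] n4 by (subst ln_le_cancel_iff) auto
      then show "ln (real (N m)) \<le> 2 * ln (real n)" using n4 by (simp add: ln_mult)
    next
      show "0 \<le> ln (real (N m))" for m using N4[of m] by simp
    qed (use D ab in auto)
    also have "\<dots> = D * (2 * ln (real n)) powr b * (\<Sum>m\<le>L. real (N m) powr a)"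
      by (simp only: sum_distrib_left sum_distrib_right mult_ac)
    also have "\<dots> \<le> D * (2 * ln (real n)) powr b * (G * (2 * real n) powr a)"
    proof (rule mult_left_mono)
      have "(\<Sum>m\<le>L. real (N m) powr a) \<le> G * real (N L) powr a"
        using sum_powr_dyadic_le[of a "real K" L] ab K by (simp add: N_def G_def)
      also have "\<dots> \<le> G * (2 * real n) powr a"
        using L(1) G ab by (intro mult_left_mono powr_mono2) auto
      finally show "(\<Sum>m\<le>L. real (N m) powr a) \<le> G * (2 * real n) powr a" .
    qed (use D in auto)
    also have "\<dots> = (2 powr a * 2 powr b) * (D * G * (ln (real n) powr b * real n powr a))"
      using n4 by (simp add: powr_mult)
    also have "2 powr a * 2 powr b = (2::real)" using ab(3) by (simp flip: powr_add)
    finally show ?thesis by simp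
  qed
  have exps: "1 / (real k - 1) = b" "(real k - 2) / (real k - 1) = a"
    by (auto simp: a_def b_def k)
  have "\<forall>\<^sub>F n in sequentially. real (counting A n) \<le>
      2 * D * G * (ln (real n) powr b * real n powr a)"
    using bound by (auto simp: eventually_sequentially)
  moreover have "2 * D * G > 0" using D G by simp
  ultimately show ?thesis unfolding exps by blast
qed

end
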